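(* For every sequent $\Gamma\Rightarrow\delta$ of first-order arithmetic: if $\mathrm{HA}\vdash\Gamma\Rightarrow\delta$ then $\mathrm{CHA}\vdash\Gamma\Rightarrow\delta$.
   Context: Language: terms from variables, $0,S,+,\cdot$; formulas from $s=t,\bot,\wedge,\vee,\to,\forall,\exists$. Sequents $\Gamma\Rightarrow\delta$: finite set $\Gamma$, single formula $\delta$. $\mathrm{HA}$: sequent calculus (finite tree proofs) with the standard intuitionistic rules Ax ($\Gamma,\delta\Rightarrow\delta$), $\to$L/R, $\wedge$L/R, $\vee$L/R, $\forall$L/R, $\exists$L/R (usual eigenvariable conditions), $\bot$L, $=$L (from $\Gamma[x/y]\Rightarrow\delta[x/y]$ infer $\Gamma[s/x,t/y],s=t\Rightarrow\delta[s/x,t/y]$, $x,y\notin\mathrm{FV}(s,t)$), $=$R ($\Gamma\Rightarrow t=t$), weakening, cut, arithmetic axioms $\Rightarrow 0\neq St$, $Ss=St\Rightarrow s=t$, $\Rightarrow s+0=s$, $\Rightarrow s+St=S(s+t)$, $\Rightarrow s\cdot0=0$, $\Rightarrow s\cdot St=(s\cdot t)+s$, and induction axioms $\varphi(0),\forall x.\,\varphi(x)\to\varphi(Sx)\Rightarrow\varphi(s)$ for all formulas $\varphi$ and terms $s$. $\mathrm{CHA}$: rules of $\mathrm{HA}$ without induction axioms plus $\textsc{Case}_x$ (from $\Gamma[0/x]\Rightarrow\delta[0/x]$ and $\Gamma[Sx/x]\Rightarrow\delta[Sx/x]$ infer $\Gamma\Rightarrow\delta$). A pre-proof is a finite tree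 with a partial map $\beta$ sending some leaves (buds) to inner nodes (companions); non-bud nodes carry rule instances whose premises label the children; buds carry their companion's sequent. An infinite branch starts at the root and each step goes to a child or from a bud to its companion. A $\mathrm{CHA}$-proof is a pre-proof such that along every infinite branch some variable $x$ is, from some point on, free in every sequent and the branch passes instances of $\textsc{Case}_x$ infinitely often. *)

theory Defs
  imports "HOL-Library.FSet" "HOL-Library.Infinite_Set"
begin

section \<open>Syntax of first-order arithmetic\<close>

text \<open>
  Formulas up to renaming of bound variables. An index \<open>n\<close> below \<open>k\<close> quantifiers is bound
  if \<open>n < k\<close>, and otherwise it is an occurrence of the free variable named \<open>n - k\<close>. The free
  variables of a formula are thus fixed names, which no inference rule shifts, and it is
  meaningful to say that the same variable is free in two sequents.
\<close>

datatype tm = Var nat | Zero | Succ tm | Add tm tm | Mul tm tm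

datatype fm =
    Eq tm tm    (infix "\<^bold>=" 50)
  | Bot         ("\<^bold>\<bottom>")
  | And fm fm   (infixr "\<^bold>\<and>" 45)
  | Or fm fm    (infixr "\<^bold>\<or>" 44)
  | Imp fm fm   (infixr "\<^bold>\<longrightarrow>" 43)
  | AllQ fm
  | ExQ fm

abbreviation Neg :: "fm \<Rightarrow> fm"  ("\<^bold>\<not> _" [46] 46)
  where "\<^bold>\<not> \<phi> \<equiv> \<phi> \<^bold>\<longrightarrow> \<^bold>\<bottom>"

primrec fv_tm :: "tm \<Rightarrow> nat set" where
  "fv_tm (Var n) = {n}"
| "fv_tm Zero = {}"
| "fv_tm (Succ t) = fv_tm t"
| "fv_tm (Add s t) = fv_tm s \<union> fv_tm t"
| "fv_tm (Mul s t) = fv_tm s \<union> fv_tm t"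

primrec fv :: "fm \<Rightarrow> nat set" where
  "fv (s \<^bold>= t) = fv_tm s \<union> fv_tm t"
| "fv \<^bold>\<bottom> = {}"
| "fv (\<phi> \<^bold>\<and> \<psi>) = fv \<phi> \<union> fv \<psi>"
| "fv (\<phi> \<^bold>\<or> \<psi>) = fv \<phi> \<union> fv \<psi>"
| "fv (\<phi> \<^bold>\<longrightarrow> \<psi>) = fv \<phi> \<union> fv \<psi>"
| "fv (AllQ \<phi>) = {n. Suc n \<in> fv \<phi>}"
| "fv (ExQ \<phi>) = {n. Suc n \<in> fv \<phi>}"

primrec subst_tm :: "(nat \<Rightarrow> tm) \<Rightarrow> tm \<Rightarrow> tm" where
  "subst_tm \<sigma> (Var n) = \<sigma> n"
| "subst_tm \<sigma> Zero = Zero"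
| "subst_tm \<sigma> (Succ t) = Succ (subst_tm \<sigma> t)"
| "subst_tm \<sigma> (Add s t) = Add (subst_tm \<sigma> s) (subst_tm \<sigma> t)"
| "subst_tm \<sigma> (Mul s t) = Mul (subst_tm \<sigma> s) (subst_tm \<sigma> t)"

definition lift :: "(nat \<Rightarrow> tm) \<Rightarrow> nat \<Rightarrow> tm" where
  "lift \<sigma> = case_nat (Var 0) (\<lambda>n. subst_tm (\<lambda>m. Var (Suc m)) (\<sigma> n))"

text \<open>Simultaneous capture-avoiding substitution for the free variables.\<close>

primrec subst :: "(nat \<Rightarrow> tm) \<Rightarrow> fm \<Rightarrow> fm" where
  "subst \<sigma> (s \<^bold>= t) = (subst_tm \<sigma> s \<^bold>= subst_tm \<sigma> t)"
| "subst \<sigma> \<^bold>\<bottom> = \<^bold>\<bottom>"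
| "subst \<sigma> (\<phi> \<^bold>\<and> \<psi>) = (subst \<sigma> \<phi> \<^bold>\<and> subst \<sigma> \<psi>)"
| "subst \<sigma> (\<phi> \<^bold>\<or> \<psi>) = (subst \<sigma> \<phi> \<^bold>\<or> subst \<sigma> \<psi>)"
| "subst \<sigma> (\<phi> \<^bold>\<longrightarrow> \<psi>) = (subst \<sigma> \<phi> \<^bold>\<longrightarrow> subst \<sigma> \<psi>)"
| "subst \<sigma> (AllQ \<phi>) = AllQ (subst (lift \<sigma>) \<phi>)"
| "subst \<sigma> (ExQ \<phi>) = ExQ (subst (lift \<sigma>) \<phi>)"

abbreviation subst1 :: "fm \<Rightarrow> nat \<Rightarrow> tm \<Rightarrow> fm"  ("_\<langle>_ := _\<rangle>" [1000, 0, 0] 1000)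
  where "\<phi>\<langle>x := t\<rangle> \<equiv> subst (Var(x := t)) \<phi>"

text \<open>
  Quantification over a named variable \<open>x\<close>: its free occurrences become the index bound by
  the new quantifier. Every formula \<open>AllQ \<phi>\<close> is of the form \<open>Forall x \<psi>\<close> (lemma
  \<open>AllQ_eq_Forall\<close> below), so the rules may be stated with named quantifiers.
\<close>

definition bind :: "nat \<Rightarrow> fm \<Rightarrow> fm" where
  "bind x = subst (\<lambda>n. if n = x then Var 0 else Var (Suc n))"

definition Forall :: "nat \<Rightarrow> fm \<Rightarrow> fm" where "Forall x \<phi> = AllQ (bind x \<phi>)"
definition Exists :: "nat \<Rightarrow> fm \<Rightarrow> fm" where "Exists x \<phi> = ExQ (bind x \<phi>)"

lemma fv_subst_tm: "fv_tm (subst_tm \<sigma> t) = (\<Union>n\<in>fv_tm t. fv_tm (\<sigma> n))"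
  by (induction t) auto

lemma fv_lift:
  "{n. Suc n \<in> (\<Union>m\<in>A. fv_tm (lift \<sigma> m))} = (\<Union>n\<in>{n. Suc n \<in> A}. fv_tm (\<sigma> n))"
proof (intro set_eqI iffI)
  fix n assume "n \<in> {n. Suc n \<in> (\<Union>m\<in>A. fv_tm (lift \<sigma> m))}"
  then obtain m where "m \<in> A" "Suc n \<in> fv_tm (lift \<sigma> m)" by blast
  then show "n \<in> (\<Union>n\<in>{n. Suc n \<in> A}. fv_tm (\<sigma> n))"
    by (cases m) (auto simp: lift_def fv_subst_tm)
next
  fix n assume "n \<in> (\<Union>n\<in>{n. Suc n \<in> A}. fv_tm (\<sigma> n))"
  then obtain m where "Suc m \<in> A" "n \<in> fv_tm (\<sigma> m)" by blast
  then have "Suc n \<in> fv_tm (lift \<sigma> (Suc m))" by (auto simp: lift_def fv_subst_tm)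
  with \<open>Suc m \<in> A\<close> show "n \<in> {n. Suc n \<in> (\<Union>m\<in>A. fv_tm (lift \<sigma> m))}" by blast
qed

lemma fv_subst: "fv (subst \<sigma> \<phi>) = (\<Union>n\<in>fv \<phi>. fv_tm (\<sigma> n))"
proof (induction \<phi> arbitrary: \<sigma>)
  case (AllQ \<phi>)
  show ?case unfolding subst.simps fv.simps AllQ.IH by (rule fv_lift)
next
  case (ExQ \<phi>)
  show ?case unfolding subst.simps fv.simps ExQ.IH by (rule fv_lift)
qed (auto simp: fv_subst_tm)

lemma fv_Forall: "fv (Forall x \<phi>) = fv \<phi> - {x}"
  and fv_Exists: "fv (Exists x \<phi>) = fv \<phi> - {x}"
  by (auto simp: Forall_def Exists_def bind_def fv_subst split: if_splits)

lemma subst_tm_subst_tm: "subst_tm \<tau> (subst_tm \<sigma> t) = subst_tm (\<lambda>n. subst_tm \<tau> (\<sigma> n)) t"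
  by (induction t) auto

lemma subst_subst: "subst \<tau> (subst \<sigma> \<phi>) = subst (\<lambda>n. subst_tm \<tau> (\<sigma> n)) \<phi>"
proof -
  have "(\<lambda>n. subst_tm (lift \<tau>) (lift \<sigma> n)) = lift (\<lambda>n. subst_tm \<tau> (\<sigma> n))" for \<sigma> \<tau>
    by (auto simp: lift_def subst_tm_subst_tm fun_eq_iff split: nat.splits)
  then show ?thesis by (induction \<phi> arbitrary: \<sigma> \<tau>) (auto simp: subst_tm_subst_tm)
qed

lemma subst_tm_id: "(\<And>n. n \<in> fv_tm t \<Longrightarrow> \<sigma> n = Var n) \<Longrightarrow> subst_tm \<sigma> t = t"
  by (induction t) auto

lemma lift_id: "(\<And>n. Suc n \<in> A \<Longrightarrow> \<sigma> n = Var n) \<Longrightarrow> n \<in> A \<Longrightarrow> lift \<sigma> n = Var n"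
  by (cases n) (auto simp: lift_def)

lemma subst_id: "(\<And>n. n \<in> fv \<phi> \<Longrightarrow> \<sigma> n = Var n) \<Longrightarrow> subst \<sigma> \<phi> = \<phi>"
proof (induction \<phi> arbitrary: \<sigma>)
  case (AllQ \<phi>)
  then have "subst (lift \<sigma>) \<phi> = \<phi>" by (auto intro!: AllQ.IH lift_id[where A = "fv \<phi>"])
  then show ?case by simp
next
  case (ExQ \<phi>)
  then have "subst (lift \<sigma>) \<phi> = \<phi>" by (auto intro!: ExQ.IH lift_id[where A = "fv \<phi>"])
  then show ?case by simp
qed (auto intro: subst_tm_id)

lemma bind_surj: "x \<notin> fv (AllQ \<phi>) \<Longrightarrow> \<exists>\<psi>. bind x \<psi> = \<phi>"
  by (rule exI[of _ "subst (case_nat (Var x) Var) \<phi>"])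
    (auto simp: bind_def subst_subst intro!: subst_id split: nat.splits)

lemma AllQ_eq_Forall: "x \<notin> fv (AllQ \<phi>) \<Longrightarrow> \<exists>\<psi>. AllQ \<phi> = Forall x \<psi>"
  and ExQ_eq_Exists: "x \<notin> fv (ExQ \<phi>) \<Longrightarrow> \<exists>\<psi>. ExQ \<phi> = Exists x \<psi>"
  using bind_surj[of x \<phi>] by (auto simp: Forall_def Exists_def)


section \<open>Sequents and inference rules\<close>

datatype sequent = Sequent (ante: "fm fset") (succ: fm)  (infix "\<^bold>\<Rightarrow>" 40)

definition fv_seq :: "sequent \<Rightarrow> nat set" where
  "fv_seq S = (\<Union>\<phi>\<in>fset (ante S). fv \<phi>) \<union> fv (succ S)"

definition subst_seq :: "(nat \<Rightarrow> tm) \<Rightarrow> sequent \<Rightarrow> sequent" where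
  "subst_seq \<sigma> S = (subst \<sigma> |`| ante S \<^bold>\<Rightarrow> subst \<sigma> (succ S))"

text \<open>
  \<open>rule Ps S\<close>: \<open>S\<close> follows from the list of premises \<open>Ps\<close> by a rule common to \<open>HA\<close> and
  \<open>CHA\<close>.
\<close>

inductive rule :: "sequent list \<Rightarrow> sequent \<Rightarrow> bool" where
  Ax: "rule [] (finsert \<delta> \<Gamma> \<^bold>\<Rightarrow> \<delta>)"
| ImpL: "rule [\<Gamma> \<^bold>\<Rightarrow> \<phi>, finsert \<psi> \<Gamma> \<^bold>\<Rightarrow> \<delta>] (finsert (\<phi> \<^bold>\<longrightarrow> \<psi>) \<Gamma> \<^bold>\<Rightarrow> \<delta>)"
| ImpR: "rule [finsert \<phi> \<Gamma> \<^bold>\<Rightarrow> \<psi>] (\<Gamma> \<^bold>\<Rightarrow> (\<phi> \<^bold>\<longrightarrow> \<psi>))"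
| AndL: "rule [finsert \<phi> (finsert \<psi> \<Gamma>) \<^bold>\<Rightarrow> \<delta>] (finsert (\<phi> \<^bold>\<and> \<psi>) \<Gamma> \<^bold>\<Rightarrow> \<delta>)"
| AndR: "rule [\<Gamma> \<^bold>\<Rightarrow> \<phi>, \<Gamma> \<^bold>\<Rightarrow> \<psi>] (\<Gamma> \<^bold>\<Rightarrow> (\<phi> \<^bold>\<and> \<psi>))"
| OrL: "rule [finsert \<phi> \<Gamma> \<^bold>\<Rightarrow> \<delta>, finsert \<psi> \<Gamma> \<^bold>\<Rightarrow> \<delta>] (finsert (\<phi> \<^bold>\<or> \<psi>) \<Gamma> \<^bold>\<Rightarrow> \<delta>)"
| OrR1: "rule [\<Gamma> \<^bold>\<Rightarrow> \<phi>] (\<Gamma> \<^bold>\<Rightarrow> (\<phi> \<^bold>\<or> \<psi>))"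
| OrR2: "rule [\<Gamma> \<^bold>\<Rightarrow> \<psi>] (\<Gamma> \<^bold>\<Rightarrow> (\<phi> \<^bold>\<or> \<psi>))"
| AllL: "rule [finsert (\<phi>\<langle>x := t\<rangle>) \<Gamma> \<^bold>\<Rightarrow> \<delta>] (finsert (Forall x \<phi>) \<Gamma> \<^bold>\<Rightarrow> \<delta>)"
| AllR: "y \<notin> fv_seq (\<Gamma> \<^bold>\<Rightarrow> Forall x \<phi>) \<Longrightarrow>
    rule [\<Gamma> \<^bold>\<Rightarrow> \<phi>\<langle>x := Var y\<rangle>] (\<Gamma> \<^bold>\<Rightarrow> Forall x \<phi>)"
| ExL: "y \<notin> fv_seq (finsert (Exists x \<phi>) \<Gamma> \<^bold>\<Rightarrow> \<delta>) \<Longrightarrow>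
    rule [finsert (\<phi>\<langle>x := Var y\<rangle>) \<Gamma> \<^bold>\<Rightarrow> \<delta>] (finsert (Exists x \<phi>) \<Gamma> \<^bold>\<Rightarrow> \<delta>)"
| ExR: "rule [\<Gamma> \<^bold>\<Rightarrow> \<phi>\<langle>x := t\<rangle>] (\<Gamma> \<^bold>\<Rightarrow> Exists x \<phi>)"
| BotL: "rule [] (finsert \<^bold>\<bottom> \<Gamma> \<^bold>\<Rightarrow> \<delta>)"
| EqL: "x \<noteq> y \<Longrightarrow> {x, y} \<inter> (fv_tm s \<union> fv_tm t) = {} \<Longrightarrow>
    rule [subst (Var(y := Var x)) |`| \<Gamma> \<^bold>\<Rightarrow> subst (Var(y := Var x)) \<delta>]
      (finsert (s \<^bold>= t) (subst (Var(x := s, y := t)) |`| \<Gamma>) \<^bold>\<Rightarrow> subst (Var(x := s, y := t)) \<delta>)"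
| EqR: "rule [] (\<Gamma> \<^bold>\<Rightarrow> (t \<^bold>= t))"
| Weak: "\<Gamma> |\<subseteq>| \<Gamma>' \<Longrightarrow> rule [\<Gamma> \<^bold>\<Rightarrow> \<delta>] (\<Gamma>' \<^bold>\<Rightarrow> \<delta>)"
| Cut: "rule [\<Gamma> \<^bold>\<Rightarrow> \<phi>, finsert \<phi> \<Gamma> \<^bold>\<Rightarrow> \<delta>] (\<Gamma> \<^bold>\<Rightarrow> \<delta>)"
| Zero_neq_Succ: "rule [] ({||} \<^bold>\<Rightarrow> (\<^bold>\<not> (Zero \<^bold>= Succ t)))"
| Succ_inj: "rule [] ({|Succ s \<^bold>= Succ t|} \<^bold>\<Rightarrow> (s \<^bold>= t))"
| Add_Zero: "rule [] ({||} \<^bold>\<Rightarrow> (Add s Zero \<^bold>= s))"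
| Add_Succ: "rule [] ({||} \<^bold>\<Rightarrow> (Add s (Succ t) \<^bold>= Succ (Add s t)))"
| Mul_Zero: "rule [] ({||} \<^bold>\<Rightarrow> (Mul s Zero \<^bold>= Zero))"
| Mul_Succ: "rule [] ({||} \<^bold>\<Rightarrow> (Mul s (Succ t) \<^bold>= Add (Mul s t) s))"


section \<open>Heyting arithmetic\<close>

inductive HA :: "sequent \<Rightarrow> bool" where
  HA_rule: "rule Ps S \<Longrightarrow> (\<forall>P\<in>set Ps. HA P) \<Longrightarrow> HA S"
| HA_ind: "HA ({|\<phi>\<langle>x := Zero\<rangle>, Forall x (\<phi> \<^bold>\<longrightarrow> \<phi>\<langle>x := Succ (Var x)\<rangle>)|} \<^bold>\<Rightarrow> \<phi>\<langle>x := s\<rangle>)"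


section \<open>Cyclic Heyting arithmetic\<close>

datatype label = Common | Case nat

inductive CHA_rule :: "label \<Rightarrow> sequent list \<Rightarrow> sequent \<Rightarrow> bool" where
  Common: "rule Ps S \<Longrightarrow> CHA_rule Common Ps S"
| Case: "CHA_rule (Case x)
    [subst_seq (Var(x := Zero)) S, subst_seq (Var(x := Succ (Var x))) S] S"

text \<open>
  Nodes are addressed by the list of child indices on the path from the root. A bud carries
  its sequent and the address of its companion, so the buds make up the partial map \<open>\<beta>\<close>.
  A companion may be any inner node, not only an ancestor of the bud.
\<close>

datatype tree =
    Node (seq: sequent) label "tree list"
  | Bud (seq: sequent) "nat list"

fun subtree :: "tree \<Rightarrow> nat list \<Rightarrow> tree option" where
  "subtree T [] = Some T"
| "subtree (Node S r Ts) (i # p) = (if i < length Ts then subtree (Ts ! i) p else None)"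
| "subtree (Bud S q) (i # p) = None"

definition preproof :: "tree \<Rightarrow> bool" where
  "preproof T \<longleftrightarrow>
    (\<forall>p S r Ts. subtree T p = Some (Node S r Ts) \<longrightarrow> CHA_rule r (map seq Ts) S) \<and>
    (\<forall>p S q. subtree T p = Some (Bud S q) \<longrightarrow>
      (\<exists>r Ts. subtree T q = Some (Node S r Ts) \<and> Ts \<noteq> []))"

definition step :: "tree \<Rightarrow> nat list \<Rightarrow> nat list \<Rightarrow> bool" where
  "step T p q \<longleftrightarrow>
    (\<exists>i. q = p @ [i] \<and> subtree T q \<noteq> None) \<or> (\<exists>S. subtree T p = Some (Bud S q))"

definition infinite_branch :: "tree \<Rightarrow> (nat \<Rightarrow> nat list) \<Rightarrow> bool" where
  "infinite_branch T b \<longleftrightarrow> b 0 = [] \<and> (\<forall>n. step T (b n) (b (Suc n)))"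

definition CHA_proof :: "tree \<Rightarrow> bool" where
  "CHA_proof T \<longleftrightarrow> preproof T \<and>
    (\<forall>b. infinite_branch T b \<longrightarrow>
      (\<exists>x. (\<exists>N. \<forall>n\<ge>N. x \<in> fv_seq (seq (the (subtree T (b n))))) \<and>
           (\<exists>\<^sub>\<infinity>n. \<exists>S Ts. subtree T (b n) = Some (Node S (Case x) Ts))))"

definition CHA :: "sequent \<Rightarrow> bool" where
  "CHA S \<longleftrightarrow> (\<exists>T. CHA_proof T \<and> seq T = S)"

end

(*
  CHA is closed under the rules it shares with HA: the proofs of the premises are placed side by
  side, and an infinite branch of the result eventually stays in one of them. It remains to prove
  the induction axioms. Let D consist of the formulas phi(0) and "forall x. phi -> phi(Sx)", in
  which x is not free. If x is not free in phi, then phi(s) = phi(0) and the axiom is an instance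
  of Ax. Otherwise Case_x reduces D => phi to D => phi(0), an instance of Ax, and to
  D => phi(Sx), which follows from D => phi by the second formula of D. The premise D => phi is
  a bud whose companion is the root, and x is free along the resulting cycle. As CHA has no
  substitution rule, D => phi(s) is obtained from D => phi by a cut on "forall x. phi".
*)
theory Submission
  imports Defs
begin

section \<open>Proofs placed side by side below a new root\<close>

text \<open>Buds store addresses counted from the root of the whole tree, so when a tree becomes the
  \<open>i\<close>-th child of a new root, each companion address must be prefixed by
  \<open>i\<close>.\<close>

primrec relocate :: "nat \<Rightarrow> tree \<Rightarrow> tree" where
  "relocate i (Node S r Ts) = Node S r (map (relocate i) Ts)"
| "relocate i (Bud S q) = Bud S (i # q)"

lemma seq_relocate [simp]: "seq (relocate i T) = seq T"
  by (cases T) auto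

lemma subtree_relocate: "subtree (relocate i T) p = map_option (relocate i) (subtree T p)"
  by (induction T p rule: subtree.induct) auto

lemma relocate_eq_Node:
  "relocate i T = Node S r Ts \<longleftrightarrow> (\<exists>Us. T = Node S r Us \<and> Ts = map (relocate i) Us)"
  by (cases T) auto

lemma relocate_eq_Bud: "relocate i T = Bud S q \<longleftrightarrow> (\<exists>q'. T = Bud S q' \<and> q = i # q')"
  by (cases T) auto

definition join :: "sequent \<Rightarrow> label \<Rightarrow> tree list \<Rightarrow> tree" where
  "join S r Ts = Node S r (map (\<lambda>i. relocate i (Ts ! i)) [0..<length Ts])"

lemma seq_join [simp]: "seq (join S r Ts) = S"
  by (simp add: join_def)

lemma subtree_join_Cons:
  "subtree (join S r Ts) (i # p) =
    (if i < length Ts then map_option (relocate i) (subtree (Ts ! i) p) else None)"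
  by (simp add: join_def subtree_relocate)

text \<open>Every address below the new root starts with some \<open>i\<close> and continues inside
  \<open>Ts ! i\<close>, where both conditions are known; the companion of a bud lies in the same
  copy as the bud. Only the root needs a check of its own, and there \<open>r\<close> is
  given.\<close>

lemma preproof_join:
  assumes r: "CHA_rule r (map seq Ts) S" and Ts: "\<And>T. T \<in> set Ts \<Longrightarrow> preproof T"
  shows "preproof (join S r Ts)"
  unfolding preproof_def
proof (intro conjI allI impI)
  fix p S' r' Us assume p: "subtree (join S r Ts) p = Some (Node S' r' Us)"
  show "CHA_rule r' (map seq Us) S'"
  proof (cases p)
    case Nil
    have "map (seq \<circ> (\<lambda>i. relocate i (Ts ! i))) [0..<length Ts] = map seq Ts"
      by (rule nth_equalityI) auto
    with p r Nil show ?thesis by (auto simp: join_def)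
  next
    case (Cons i p')
    with p obtain Vs where i: "i < length Ts"
      and Vs: "subtree (Ts ! i) p' = Some (Node S' r' Vs)" "Us = map (relocate i) Vs"
      by (auto simp: subtree_join_Cons relocate_eq_Node split: if_splits)
    with Ts[of "Ts ! i"] have "CHA_rule r' (map seq Vs) S'" by (auto simp: preproof_def)
    moreover have "map seq Us = map seq Vs" using Vs by simp
    ultimately show ?thesis by simp
  qed
next
  fix p S' q assume p: "subtree (join S r Ts) p = Some (Bud S' q)"
  then obtain i p' where "p = i # p'" by (cases p) (auto simp: join_def)
  with p obtain q' where i: "i < length Ts" and q: "q = i # q'"
    and "subtree (Ts ! i) p' = Some (Bud S' q')"
    by (auto simp: subtree_join_Cons relocate_eq_Bud split: if_splits)
  with Ts[of "Ts ! i"] obtain r' Us where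
    "subtree (Ts ! i) q' = Some (Node S' r' Us)" "Us \<noteq> []"
    unfolding preproof_def by (metis nth_mem)
  with i q show "\<exists>r' Us. subtree (join S r Ts) q = Some (Node S' r' Us) \<and> Us \<noteq> []"
    by (auto simp: subtree_join_Cons)
qed

lemma step_join_Nil:
  assumes "step (join S r Ts) [] q"
  obtains i where "i < length Ts" "q = [i]"
  using assms by (auto simp: step_def subtree_join_Cons join_def split: if_splits)

text \<open>Relocation sends each bud of the \<open>i\<close>-th copy to a companion in that same
  copy, so no step leaves it.\<close>

lemma step_join_Cons:
  assumes "i < length Ts" "step (join S r Ts) (i # p) q"
  shows "\<exists>q'. q = i # q' \<and> step (Ts ! i) p q'"
  using assms
  by (auto simp: step_def subtree_join_Cons relocate_eq_Bud split: if_splits)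

text \<open>The first step chooses \<open>i\<close> and the branch is then trapped in the
  \<open>i\<close>-th copy. The branch \<open>c\<close> omits the root at time 0 and strips the
  leading \<open>i\<close> from all later addresses.\<close>

lemma infinite_branch_join:
  assumes b: "infinite_branch (join S r Ts) b"
  obtains i c where "i < length Ts" "infinite_branch (Ts ! i) c" "\<And>n. b (Suc n) = i # c n"
proof -
  have step: "step (join S r Ts) (b n) (b (Suc n))" for n
    using b by (simp add: infinite_branch_def)
  obtain i where i: "i < length Ts" "b (Suc 0) = [i]"
    using step[of 0] b by (auto simp: infinite_branch_def elim: step_join_Nil)
  have tl: "b (Suc n) = i # tl (b (Suc n))" for n
  proof (induction n)
    case (Suc n)
    then show ?case using step_join_Cons[OF i(1)] step[of "Suc n"] by (metis list.sel(3))
  qed (simp add: i)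
  have "step (Ts ! i) (tl (b (Suc n))) (tl (b (Suc (Suc n))))" for n
    using step_join_Cons[OF i(1)] step[of "Suc n"] tl[of n] by (metis list.sel(3))
  then have "infinite_branch (Ts ! i) (\<lambda>n. tl (b (Suc n)))"
    by (simp add: infinite_branch_def i)
  with i tl show ?thesis by (intro that) auto
qed

lemma step_defined:
  assumes "preproof T" "step T p q"
  shows "subtree T q \<noteq> None"
  using assms unfolding step_def preproof_def by blast

text \<open>The trace condition reads sequents through \<open>the\<close>, which is informative only
  at existing addresses; this justifies comparing sequents before and after relocation.\<close>

lemma infinite_branch_defined:
  assumes "preproof T" "infinite_branch T b"
  shows "subtree T (b n) \<noteq> None"
  using assms by (cases n) (auto simp: infinite_branch_def dest: step_defined)

text \<open>The trace condition depends only on the tail of a branch, and relocation changes neither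
  sequents nor labels. Hence the variable \<open>x\<close> that works for \<open>c\<close> in
  \<open>Ts ! i\<close> also works for \<open>b\<close>.\<close>

lemma CHA_proof_join:
  assumes r: "CHA_rule r (map seq Ts) S" and Ts: "\<And>T. T \<in> set Ts \<Longrightarrow> CHA_proof T"
  shows "CHA_proof (join S r Ts)"
  unfolding CHA_proof_def
proof (intro conjI allI impI)
  show "preproof (join S r Ts)"
    using r Ts by (intro preproof_join) (auto simp: CHA_proof_def)
  fix b assume "infinite_branch (join S r Ts) b"
  then obtain i c where i: "i < length Ts" and c: "infinite_branch (Ts ! i) c"
    and b: "\<And>n. b (Suc n) = i # c n"
    by (rule infinite_branch_join) blast
  have proof_i: "CHA_proof (Ts ! i)" using Ts i by simp
  then obtain x N where
    N: "\<And>n. n \<ge> N \<Longrightarrow> x \<in> fv_seq (seq (the (subtree (Ts ! i) (c n))))" and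
    inf: "\<exists>\<^sub>\<infinity>n. \<exists>S' Us. subtree (Ts ! i) (c n) = Some (Node S' (Case x) Us)"
    using c unfolding CHA_proof_def by blast
  have "subtree (Ts ! i) (c n) \<noteq> None" for n
    using proof_i c by (intro infinite_branch_defined) (auto simp: CHA_proof_def)
  then have seq: "seq (the (subtree (join S r Ts) (b (Suc n)))) = seq (the (subtree (Ts ! i) (c n)))"
    for n by (simp add: b subtree_join_Cons i option.map_sel)
  \<comment> \<open>The bound \<open>N\<close> shifts by one because \<open>b\<close> spends time 0
    at the new root.\<close>
  have "x \<in> fv_seq (seq (the (subtree (join S r Ts) (b n))))" if "n \<ge> Suc N" for n
    using that N seq by (cases n) auto
  moreover have "\<exists>\<^sub>\<infinity>n. \<exists>S' Us. subtree (join S r Ts) (b n) = Some (Node S' (Case x) Us)"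
    unfolding INFM_nat
  proof
    fix m
    obtain n S' Us where "n > m" "subtree (Ts ! i) (c n) = Some (Node S' (Case x) Us)"
      using inf unfolding INFM_nat by blast
    then have "Suc n > m"
      "subtree (join S r Ts) (b (Suc n)) = Some (Node S' (Case x) (map (relocate i) Us))"
      by (auto simp: b subtree_join_Cons i)
    then show "\<exists>n>m. \<exists>S' Us. subtree (join S r Ts) (b n) = Some (Node S' (Case x) Us)" by blast
  qed
  ultimately show "\<exists>x. (\<exists>N. \<forall>n\<ge>N. x \<in> fv_seq (seq (the (subtree (join S r Ts) (b n))))) \<and>
      (\<exists>\<^sub>\<infinity>n. \<exists>S' Us. subtree (join S r Ts) (b n) = Some (Node S' (Case x) Us))"
    by blast
qed

lemma CHA_rule_closed:
  assumes "rule Ps S" "\<forall>P\<in>set Ps. CHA P"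
  shows "CHA S"
proof -
  obtain f where f: "\<forall>P\<in>set Ps. CHA_proof (f P) \<and> seq (f P) = P"
    using assms(2) unfolding CHA_def by metis
  then have "map seq (map f Ps) = Ps" by (simp add: map_idI)
  with assms(1) f have "CHA_proof (join S Common (map f Ps))"
    by (intro CHA_proof_join) (auto intro: CHA_rule.Common)
  then show ?thesis unfolding CHA_def by (metis seq_join)
qed

section \<open>The cyclic proof of the induction step and base\<close>

context
  fixes \<phi> :: fm and x :: nat
begin

definition induction_hyps :: "fm fset" where
  "induction_hyps = {|\<phi>\<langle>x := Zero\<rangle>, Forall x (\<phi> \<^bold>\<longrightarrow> \<phi>\<langle>x := Succ (Var x)\<rangle>)|}"

lemma notin_fv_induction_hyps: "\<psi> |\<in>| induction_hyps \<Longrightarrow> x \<notin> fv \<psi>"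
  by (auto simp: induction_hyps_def fv_Forall fv_subst split: if_splits)

text \<open>Since \<open>x\<close> is not free in the hypotheses, both premises of
  \<open>Case x\<close> keep the same antecedent as the conclusion.\<close>

lemma subst1_induction_hyps [simp]: "subst (Var(x := t)) |`| induction_hyps = induction_hyps"
proof -
  have "\<psi>\<langle>x := t\<rangle> = \<psi>" if "\<psi> |\<in>| induction_hyps" for \<psi>
    using notin_fv_induction_hyps[OF that] by (intro subst_id) auto
  then show ?thesis by (auto simp: fimage_iff intro!: fset_eqI)
qed

text \<open>The label \<open>Common\<close> hides the rules: \<open>[0]\<close> and
  \<open>[1, 0, 1]\<close> are instances of \<open>Ax\<close>, \<open>[1]\<close> is
  \<open>AllL\<close> with instance \<open>Var x\<close>, and \<open>[1, 0]\<close> is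
  \<open>ImpL\<close>, whose left premise is the bud back to the root.\<close>

definition cycle :: tree where
  "cycle = Node (induction_hyps \<^bold>\<Rightarrow> \<phi>) (Case x)
    [Node (induction_hyps \<^bold>\<Rightarrow> \<phi>\<langle>x := Zero\<rangle>) Common [],
     Node (induction_hyps \<^bold>\<Rightarrow> \<phi>\<langle>x := Succ (Var x)\<rangle>) Common
      [Node (finsert (\<phi> \<^bold>\<longrightarrow> \<phi>\<langle>x := Succ (Var x)\<rangle>) induction_hyps \<^bold>\<Rightarrow> \<phi>\<langle>x := Succ (Var x)\<rangle>) Common
        [Bud (induction_hyps \<^bold>\<Rightarrow> \<phi>) [],
         Node (finsert (\<phi>\<langle>x := Succ (Var x)\<rangle>) induction_hyps \<^bold>\<Rightarrow> \<phi>\<langle>x := Succ (Var x)\<rangle>) Common []]]]"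

text \<open>Listing all addresses reduces the later claims about rules, steps and sequents to finite
  case distinctions.\<close>

lemma subtree_cycle:
  "subtree cycle p = (if p = [] then Some cycle
    else if p = [0] then Some (Node (induction_hyps \<^bold>\<Rightarrow> \<phi>\<langle>x := Zero\<rangle>) Common [])
    else if p = [1] then Some (Node (induction_hyps \<^bold>\<Rightarrow> \<phi>\<langle>x := Succ (Var x)\<rangle>) Common
      [Node (finsert (\<phi> \<^bold>\<longrightarrow> \<phi>\<langle>x := Succ (Var x)\<rangle>) induction_hyps \<^bold>\<Rightarrow> \<phi>\<langle>x := Succ (Var x)\<rangle>) Common
        [Bud (induction_hyps \<^bold>\<Rightarrow> \<phi>) [],
         Node (finsert (\<phi>\<langle>x := Succ (Var x)\<rangle>) induction_hyps \<^bold>\<Rightarrow> \<phi>\<langle>x := Succ (Var x)\<rangle>) Common []]])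
    else if p = [1, 0] then Some
      (Node (finsert (\<phi> \<^bold>\<longrightarrow> \<phi>\<langle>x := Succ (Var x)\<rangle>) induction_hyps \<^bold>\<Rightarrow> \<phi>\<langle>x := Succ (Var x)\<rangle>) Common
        [Bud (induction_hyps \<^bold>\<Rightarrow> \<phi>) [],
         Node (finsert (\<phi>\<langle>x := Succ (Var x)\<rangle>) induction_hyps \<^bold>\<Rightarrow> \<phi>\<langle>x := Succ (Var x)\<rangle>) Common []])
    else if p = [1, 0, 0] then Some (Bud (induction_hyps \<^bold>\<Rightarrow> \<phi>) [])
    else if p = [1, 0, 1] then Some
      (Node (finsert (\<phi>\<langle>x := Succ (Var x)\<rangle>) induction_hyps \<^bold>\<Rightarrow> \<phi>\<langle>x := Succ (Var x)\<rangle>) Common [])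
    else None)"
proof -
  have Node_Nil: "subtree (Node S r []) p = (if p = [] then Some (Node S r []) else None)"
    and Bud: "subtree (Bud S q) p = (if p = [] then Some (Bud S q) else None)" for S r q p
    by (cases p; simp)+
  have Node_1: "subtree (Node S r [T]) p = (if p = [] then Some (Node S r [T])
      else if hd p = 0 then subtree T (tl p) else None)" for S r T p
    by (cases p) auto
  have Node_2: "subtree (Node S r [T, U]) p = (if p = [] then Some (Node S r [T, U])
      else if hd p = 0 then subtree T (tl p)
      else if hd p = 1 then subtree U (tl p) else None)" for S r T U p
    by (cases p) (auto simp: less_Suc_eq)
  show ?thesis
    unfolding cycle_def Node_Nil Node_1 Node_2 Bud
    by (cases p; cases "tl p"; cases "tl (tl p)"; simp)
qed

lemma preproof_cycle: "preproof cycle"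
proof -
  let ?\<phi>S = "\<phi>\<langle>x := Succ (Var x)\<rangle>"
  have Case: "CHA_rule (Case x) [induction_hyps \<^bold>\<Rightarrow> \<phi>\<langle>x := Zero\<rangle>, induction_hyps \<^bold>\<Rightarrow> ?\<phi>S] (induction_hyps \<^bold>\<Rightarrow> \<phi>)"
    using CHA_rule.Case[of x "induction_hyps \<^bold>\<Rightarrow> \<phi>"] by (simp add: subst_seq_def)
  have zero: "rule [] (induction_hyps \<^bold>\<Rightarrow> \<phi>\<langle>x := Zero\<rangle>)"
    using rule.Ax[of _ "induction_hyps"] by (metis finsert_absorb finsertI1 induction_hyps_def)
  \<comment> \<open>Antecedents are sets, so \<open>AllL\<close> may keep its principal formula:
    taking all hypotheses as side formulas leaves them available for the return to the root.\<close>
  have "finsert (Forall x (\<phi> \<^bold>\<longrightarrow> ?\<phi>S)) induction_hyps = induction_hyps"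
    by (auto simp: induction_hyps_def)
  moreover have "(\<phi> \<^bold>\<longrightarrow> ?\<phi>S)\<langle>x := Var x\<rangle> = (\<phi> \<^bold>\<longrightarrow> ?\<phi>S)"
    by (rule subst_id) auto
  ultimately have AllL: "rule [finsert (\<phi> \<^bold>\<longrightarrow> ?\<phi>S) induction_hyps \<^bold>\<Rightarrow> ?\<phi>S] (induction_hyps \<^bold>\<Rightarrow> ?\<phi>S)"
    using rule.AllL[where x = x and t = "Var x" and \<Gamma> = induction_hyps and \<phi> = "\<phi> \<^bold>\<longrightarrow> ?\<phi>S"] by simp
  show ?thesis
    using Case zero AllL rule.Ax[of ?\<phi>S induction_hyps] rule.ImpL[of induction_hyps \<phi> ?\<phi>S ?\<phi>S]
    unfolding preproof_def subtree_cycle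
    by (auto simp: cycle_def split: if_splits intro: CHA_rule.Common)
qed

text \<open>Apart from the two dead ends at the axioms, the only moves go round the cycle
  \<open>[]\<close>, \<open>[1]\<close>, \<open>[1, 0]\<close>, \<open>[1, 0, 0]\<close>.\<close>

lemma step_cycle:
  "step cycle [] q \<Longrightarrow> q = [0] \<or> q = [1]"
  "\<not> step cycle [0] q"
  "step cycle [1] q \<Longrightarrow> q = [1, 0]"
  "step cycle [1, 0] q \<Longrightarrow> q = [1, 0, 0] \<or> q = [1, 0, 1]"
  "step cycle [1, 0, 0] q \<Longrightarrow> q = []"
  "\<not> step cycle [1, 0, 1] q"
  by (auto simp: step_def subtree_cycle cycle_def split: if_splits)

lemma CHA_proof_cycle:
  assumes x: "x \<in> fv \<phi>"
  shows "CHA_proof cycle"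
  unfolding CHA_proof_def
proof (intro conjI preproof_cycle allI impI)
  fix b assume "infinite_branch cycle b"
  then have b0: "b 0 = []" and step: "\<And>n. step cycle (b n) (b (Suc n))"
    by (auto simp: infinite_branch_def)
  \<comment> \<open>An infinite branch always has a next step, so it never reaches an axiom.\<close>
  have alive: "b n \<noteq> [0]" "b n \<noteq> [1, 0, 1]" for n
    using step[of n] step_cycle(2,6) by metis+
  have next_Nil: "b (Suc n) = [1]" if "b n = []" for n
    using step[of n] step_cycle(1) alive that by metis
  have next_1: "b (Suc n) = [1, 0]" if "b n = [1]" for n
    using step[of n] step_cycle(3) that by metis
  have next_10: "b (Suc n) = [1, 0, 0]" if "b n = [1, 0]" for n
    using step[of n] step_cycle(4) alive that by metis
  have next_100: "b (Suc n) = []" if "b n = [1, 0, 0]" for n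
    using step[of n] step_cycle(5) that by metis
  have positions: "b n \<in> {[], [1], [1, 0], [1, 0, 0]}" for n
    by (induction n) (use b0 next_Nil next_1 next_10 next_100 in auto)
  \<comment> \<open>The term replacing \<open>x\<close> contains \<open>x\<close> again, so the
    variable survives the right premise of \<open>Case x\<close>.\<close>
  have fvS: "x \<in> fv (\<phi>\<langle>x := Succ (Var x)\<rangle>)"
    using x by (auto simp: fv_subst intro!: bexI[of _ x])
  have "x \<in> fv_seq (seq (the (subtree cycle (b n))))" for n
    using positions[of n] x fvS by (auto simp: subtree_cycle cycle_def fv_seq_def)
  moreover have "\<exists>n>m. b n = []" for m
  proof -
    \<comment> \<open>The cycle has length four, so the root, the only instance of
      \<open>Case x\<close>, recurs within four steps of any time \<open>m\<close>.\<close>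
    have "b (Suc m) = [] \<or> b (Suc (Suc m)) = [] \<or> b (Suc (Suc (Suc m))) = [] \<or>
        b (Suc (Suc (Suc (Suc m)))) = []"
      using positions[of m] next_Nil next_1 next_10 next_100 by auto
    then show ?thesis by (meson less_Suc_eq)
  qed
  then have "\<exists>\<^sub>\<infinity>n. b n = []" by (simp add: INFM_nat)
  then have "\<exists>\<^sub>\<infinity>n. \<exists>S Ts. subtree cycle (b n) = Some (Node S (Case x) Ts)"
    by (rule INFM_mono) (auto simp: cycle_def)
  ultimately show "\<exists>x. (\<exists>N. \<forall>n\<ge>N. x \<in> fv_seq (seq (the (subtree cycle (b n))))) \<and>
      (\<exists>\<^sub>\<infinity>n. \<exists>S Ts. subtree cycle (b n) = Some (Node S (Case x) Ts))"
    by blast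
qed

lemma CHA_induction: "CHA (induction_hyps \<^bold>\<Rightarrow> \<phi>\<langle>x := s\<rangle>)"
proof (cases "x \<in> fv \<phi>")
  case False
  then have "\<phi>\<langle>x := t\<rangle> = \<phi>" for t by (intro subst_id) auto
  then have "finsert (\<phi>\<langle>x := s\<rangle>) induction_hyps = induction_hyps" by (auto simp: induction_hyps_def)
  then have "rule [] (induction_hyps \<^bold>\<Rightarrow> \<phi>\<langle>x := s\<rangle>)" by (metis rule.Ax)
  then show ?thesis by (rule CHA_rule_closed) simp
next
  case True
  have "CHA (induction_hyps \<^bold>\<Rightarrow> \<phi>)"
    unfolding CHA_def using CHA_proof_cycle[OF True] by (auto simp: cycle_def)
  \<comment> \<open>In \<open>AllR\<close> the variable \<open>x\<close> serves as its own
    eigenvariable, so the premise is the root sequent of \<open>cycle\<close> itself.\<close>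
  moreover have "\<phi>\<langle>x := Var x\<rangle> = \<phi>" by (rule subst_id) auto
  moreover have "x \<notin> fv_seq (induction_hyps \<^bold>\<Rightarrow> Forall x \<phi>)"
    using notin_fv_induction_hyps by (auto simp: fv_seq_def fv_Forall)
  ultimately have "CHA (induction_hyps \<^bold>\<Rightarrow> Forall x \<phi>)"
    by (intro CHA_rule_closed[OF rule.AllR]) auto
  moreover have "CHA (finsert (Forall x \<phi>) induction_hyps \<^bold>\<Rightarrow> \<phi>\<langle>x := s\<rangle>)"
    \<comment> \<open>Instantiating the cut formula at \<open>s\<close> puts the succedent into the
      antecedent, which \<open>Ax\<close> closes.\<close>
    by (rule CHA_rule_closed[OF rule.AllL[where t = s]]) (auto intro: CHA_rule_closed[OF rule.Ax])
  ultimately show ?thesis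
    by (intro CHA_rule_closed[OF rule.Cut]) auto
qed

end

section \<open>Translation of \<open>HA\<close> derivations\<close>

theorem theorem2p7:
  fixes \<Gamma> :: "fm fset" and \<delta> :: fm
  assumes "HA (\<Gamma> \<^bold>\<Rightarrow> \<delta>)"
  shows "CHA (\<Gamma> \<^bold>\<Rightarrow> \<delta>)"
  using assms
proof (induction rule: HA.induct)
  case (HA_rule Ps S)
  then show ?case by (auto intro: CHA_rule_closed)
next
  case (HA_ind \<phi> x s)
  show ?case using CHA_induction by (simp add: induction_hyps_def)
qed

end
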